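(* Let $c>0$, $n,m\ge1$, let $\bm{z}_1,\dots,\bm{z}_m\in\mathbb{R}^n$ be nonzero and $r_1,\dots,r_m\in\mathbb{R}$. For $\bm{x}\in\mathbb{B}^n_c$ and $1\le k\le m$ let $$v_k(\bm{x})=\frac{2\|\bm{z}_k\|}{\sqrt c}\,\sinh^{-1}\left(\lambda^c_{\bm{x}}\left\langle\sqrt c\,\bm{x},\frac{\bm{z}_k}{\|\bm{z}_k\|}\right\rangle\cosh(2\sqrt c\,r_k)-(\lambda^c_{\bm{x}}-1)\sinh(2\sqrt c\,r_k)\right),$$ and define the output of the Poincaré fully-connected layer by $$\bm{y}=\frac{\bm{w}}{1+\sqrt{1+c\|\bm{w}\|^2}},\qquad \bm{w}=\left(\frac{1}{\sqrt c}\sinh(\sqrt c\,v_k(\bm{x}))\right)_{k=1}^m\in\mathbb{R}^m.$$ Then $\bm{y}\in\mathbb{B}^m_c$, and for every $k\in\{1,\dots,m\}$ the signed distance from $\bm{y}$ to the Poincaré hyperplane $\bar H_k=\{\bm{u}=(u_1,\dots,u_m)\in\mathbb{B}^m_c: u_k=0\}$ containing the origin and orthogonal to the $k$-th axis equals $v_k(\bm{x})$, that is, $$\operatorname{sign}(y_k)\,d_c(\bm{y},\bar H_k)=v_k(\bm{x}).$$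
   Context: $\|\cdot\|$ and $\langle\cdot,\cdot\rangle$ are the Euclidean norm and inner product, and $\operatorname{sign}(0)=0$. The Poincaré ball of curvature $-c$ is $\mathbb{B}^n_c=\{\bm{x}\in\mathbb{R}^n: c\|\bm{x}\|^2<1\}$ with conformal factor $\lambda^c_{\bm{x}}=2/(1-c\|\bm{x}\|^2)$. Möbius addition is $$\bm{x}\oplus_c\bm{y}=\frac{(1+2c\langle\bm{x},\bm{y}\rangle+c\|\bm{y}\|^2)\bm{x}+(1-c\|\bm{x}\|^2)\bm{y}}{1+2c\langle\bm{x},\bm{y}\rangle+c^2\|\bm{x}\|^2\|\bm{y}\|^2}.$$ The hyperbolic distance is $d_c(\bm{x},\bm{y})=\frac{2}{\sqrt c}\tanh^{-1}\left(\sqrt c\,\|(-\bm{x})\oplus_c\bm{y}\|\right)$, and for a nonempty subset $H$ of the ball, $d_c(\bm{x},H)=\inf_{\bm{u}\in H}d_c(\bm{x},\bm{u})$. *)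

theory Defs
  imports "HOL-Analysis.Analysis"
begin

definition poincare_ball :: "real \<Rightarrow> 'a::real_inner set" where
  "poincare_ball c = {x. c * (norm x)\<^sup>2 < 1}"

definition conformal_factor :: "real \<Rightarrow> 'a::real_inner \<Rightarrow> real" where
  "conformal_factor c x = 2 / (1 - c * (norm x)\<^sup>2)"

definition mobius_add :: "real \<Rightarrow> 'a::real_inner \<Rightarrow> 'a \<Rightarrow> 'a" where
  "mobius_add c x y =
     ((1 + 2 * c * (x \<bullet> y) + c * (norm y)\<^sup>2) *\<^sub>R x + (1 - c * (norm x)\<^sup>2) *\<^sub>R y)
       /\<^sub>R (1 + 2 * c * (x \<bullet> y) + c\<^sup>2 * (norm x)\<^sup>2 * (norm y)\<^sup>2)"

definition hyp_dist :: "real \<Rightarrow> 'a::real_inner \<Rightarrow> 'a \<Rightarrow> real" where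
  "hyp_dist c x y = 2 / sqrt c * artanh (sqrt c * norm (mobius_add c (- x) y))"

(* Real-valued infimum: only meaningful for nonempty H inside the ball (c > 0),
   where the distances are bounded below by 0. *)
definition hyp_dist_set :: "real \<Rightarrow> 'a::real_inner \<Rightarrow> 'a set \<Rightarrow> real" where
  "hyp_dist_set c x H = (INF u\<in>H. hyp_dist c x u)"

definition axis_hyperplane :: "real \<Rightarrow> 'm::finite \<Rightarrow> (real ^ 'm) set" where
  "axis_hyperplane c k = {u \<in> poincare_ball c. u $ k = 0}"

definition poincare_mlr :: "real \<Rightarrow> 'a::real_inner \<Rightarrow> real \<Rightarrow> 'a \<Rightarrow> real" where
  "poincare_mlr c z r x =
     2 * norm z / sqrt c *
       arsinh (conformal_factor c x * ((sqrt c *\<^sub>R x) \<bullet> (z /\<^sub>R norm z)) * cosh (2 * sqrt c * r)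
               - (conformal_factor c x - 1) * sinh (2 * sqrt c * r))"

definition poincare_fc_w ::
    "real \<Rightarrow> ('m::finite \<Rightarrow> 'a::real_inner) \<Rightarrow> ('m \<Rightarrow> real) \<Rightarrow> 'a \<Rightarrow> real ^ 'm" where
  "poincare_fc_w c z r x = (\<chi> k. 1 / sqrt c * sinh (sqrt c * poincare_mlr c (z k) (r k) x))"

definition poincare_fc ::
    "real \<Rightarrow> ('m::finite \<Rightarrow> 'a::real_inner) \<Rightarrow> ('m \<Rightarrow> real) \<Rightarrow> 'a \<Rightarrow> real ^ 'm" where
  "poincare_fc c z r x =
     poincare_fc_w c z r x /\<^sub>R (1 + sqrt (1 + c * (norm (poincare_fc_w c z r x))\<^sup>2))"

end

(* In the hyperboloid model a point y of the ball becomes the pair of the time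
   coordinate conformal_factor c y - 1 and the space part
   sqrt c *R conformal_factor c y *R y, and cosh (sqrt c * d) is minus the Lorentz product.
   The layer rescales w so that the space part of y is exactly sqrt c *R w, whose k-th entry
   is sinh (sqrt c * v k).  Dropping the k-th entry and applying the reversed Cauchy-Schwarz
   inequality shows that cosh (sqrt c * d) is at least cosh (sqrt c * v k) on the
   hyperplane, with equality at the renormalised projection. *)

theory Submission
  imports Defs
begin

section \<open>Hyperbolic distance as a Lorentz product\<close>

text \<open>The squared norm of the numerator of the Moebius sum factors as its denominator times
  \<open>(norm (x + y))\<^sup>2\<close>, so one power of the denominator cancels.\<close>

lemma norm_mobius_add_squared:
  fixes x y :: "'a::real_inner"
  shows "(norm (mobius_add c x y))\<^sup>2 =
    (norm (x + y))\<^sup>2 / (1 + 2 * c * (x \<bullet> y) + c\<^sup>2 * (norm x)\<^sup>2 * (norm y)\<^sup>2)"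
proof -
  define X Y I where "X = x \<bullet> x" and "Y = y \<bullet> y" and "I = x \<bullet> y"
  define D where "D = 1 + 2 * c * I + c\<^sup>2 * X * Y"
  define A B where "A = 1 + 2 * c * I + c * Y" and "B = 1 - c * X"
  have "(norm (A *\<^sub>R x + B *\<^sub>R y))\<^sup>2 = A\<^sup>2 * X + 2 * A * B * I + B\<^sup>2 * Y"
    unfolding power2_norm_eq_inner X_def Y_def I_def
    by (simp add: inner_add_left inner_add_right inner_commute[of y x] power2_eq_square
        algebra_simps)
  also have "\<dots> = D * (X + 2 * I + Y)"
    unfolding A_def B_def D_def by algebra
  also have "X + 2 * I + Y = (norm (x + y))\<^sup>2"
    unfolding power2_norm_eq_inner X_def Y_def I_def
    by (simp add: inner_add_left inner_add_right inner_commute[of y x])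
  finally have "(norm (A *\<^sub>R x + B *\<^sub>R y))\<^sup>2 = D * (norm (x + y))\<^sup>2" .
  moreover have "mobius_add c x y = (A *\<^sub>R x + B *\<^sub>R y) /\<^sub>R D"
    by (simp add: mobius_add_def A_def B_def D_def X_def Y_def I_def power2_norm_eq_inner)
  ultimately have "(norm (mobius_add c x y))\<^sup>2 = D * (norm (x + y))\<^sup>2 / D\<^sup>2"
    by (simp add: power_mult_distrib divide_inverse power_inverse mult.commute)
  \<comment> \<open>This also covers \<open>D = 0\<close>, where both sides are 0 by the convention
    for division.\<close>
  also have "\<dots> = (norm (x + y))\<^sup>2 / D"
    by (simp add: power2_eq_square)
  finally show ?thesis
    by (simp add: D_def X_def Y_def I_def power2_norm_eq_inner)
qed

text \<open>\<open>2 * artanh t\<close> is the logarithm of \<open>(1 + t) / (1 - t)\<close>, and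
  cosh of a logarithm is rational. The result depends only on \<open>t\<^sup>2\<close>, so the
  squared norm of the Moebius sum determines cosh of the scaled distance.\<close>

lemma cosh_double_artanh:
  fixes t :: real
  assumes "\<bar>t\<bar> < 1"
  shows "cosh (2 * artanh t) = (1 + t\<^sup>2) / (1 - t\<^sup>2)"
proof -
  have "1 + t > 0" "1 - t > 0"
    using assms by auto
  then have "cosh (2 * artanh t) = ((1 + t) / (1 - t) + (1 - t) / (1 + t)) / 2"
    by (simp add: artanh_def cosh_ln_real)
  also have "\<dots> = ((1 + t) * (1 + t) + (1 - t) * (1 - t)) / ((1 - t) * (1 + t)) / 2"
    using \<open>1 + t > 0\<close> \<open>1 - t > 0\<close> by (simp add: add_frac_eq)
  also have "(1 + t) * (1 + t) + (1 - t) * (1 - t) = (1 + t\<^sup>2) * 2"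
    by algebra
  also have "(1 + t\<^sup>2) * 2 / ((1 - t) * (1 + t)) / 2 = (1 + t\<^sup>2) / ((1 - t) * (1 + t))"
    by (simp del: distrib_right_numeral)
  also have "(1 - t) * (1 + t) = 1 - t\<^sup>2"
    by (simp add: power2_eq_square algebra_simps)
  finally show ?thesis .
qed

text \<open>With \<open>t\<^sup>2 = N / D\<close> for the argument \<open>t\<close> of
  \<open>artanh\<close>, cosh of the scaled distance is \<open>(D + N) / (D - N)\<close>, and
  \<open>D - N\<close> splits into the two factors that define the conformal factors.\<close>

lemma
  fixes x y :: "'a::real_inner"
  assumes c: "c > 0" and x: "x \<in> poincare_ball c" and y: "y \<in> poincare_ball c"
  shows hyp_dist_nonneg: "hyp_dist c x y \<ge> 0"
    and cosh_hyp_dist: "cosh (sqrt c * hyp_dist c x y) =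
      (conformal_factor c x - 1) * (conformal_factor c y - 1)
        - c * conformal_factor c x * conformal_factor c y * (x \<bullet> y)"
proof -
  define X Y I where "X = (norm x)\<^sup>2" and "Y = (norm y)\<^sup>2" and "I = x \<bullet> y"
  define D where "D = 1 - 2 * c * I + c\<^sup>2 * X * Y"
  define N where "N = c * (X - 2 * I + Y)"
  define t where "t = sqrt c * norm (mobius_add c (- x) y)"
  have px: "1 - c * X > 0" and py: "1 - c * Y > 0"
    using x y by (auto simp: poincare_ball_def X_def Y_def)
  have dist: "(norm (- x + y))\<^sup>2 = X - 2 * I + Y"
    unfolding X_def Y_def I_def power2_norm_eq_inner
    by (simp add: inner_diff_left inner_diff_right inner_commute[of y x])
  then have "N \<ge> 0"
    unfolding N_def using c by (metis mult_nonneg_nonneg less_imp_le zero_le_power2)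
  \<comment> \<open>Positivity of this product gives \<open>N < D\<close>, which keeps
    \<open>t\<close> inside the domain of \<open>artanh\<close>.\<close>
  have DN: "D - N = (1 - c * X) * (1 - c * Y)"
    unfolding D_def N_def by algebra
  then have "D > N"
    using px py by (metis diff_gt_0_iff_gt mult_pos_pos)
  then have "D > 0"
    using \<open>N \<ge> 0\<close> by linarith
  have t2: "t\<^sup>2 = N / D"
    using c by (simp add: t_def power_mult_distrib norm_mobius_add_squared dist[simplified]
        N_def D_def X_def Y_def I_def)
  then have "t\<^sup>2 < 1"
    using \<open>D > N\<close> \<open>D > 0\<close> by simp
  then have t1: "\<bar>t\<bar> < 1"
    by (simp add: abs_square_less_1)
  have "t \<ge> 0"
    using c by (simp add: t_def)
  then have "artanh t \<ge> 0"
    using t1 by (simp add: artanh_def)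
  moreover have d: "sqrt c * hyp_dist c x y = 2 * artanh t"
    using c by (simp add: hyp_dist_def t_def)
  ultimately show "hyp_dist c x y \<ge> 0"
    using c by (metis mult_2 add_nonneg_nonneg real_sqrt_gt_zero zero_le_mult_iff not_less)
  have "cosh (sqrt c * hyp_dist c x y) = (D + N) / (D - N)"
    unfolding d cosh_double_artanh[OF t1] t2 using \<open>D > 0\<close> \<open>D > N\<close> by (simp add: field_simps)
  also have "\<dots> = (2 / (1 - c * X) - 1) * (2 / (1 - c * Y) - 1)
      - c * (2 / (1 - c * X)) * (2 / (1 - c * Y)) * I"
  proof -
    have "D + N = (1 + c * X) * (1 + c * Y) - 4 * c * I"
      unfolding D_def N_def by algebra
    moreover have "2 / (1 - c * X) - 1 = (1 + c * X) / (1 - c * X)"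
      and "2 / (1 - c * Y) - 1 = (1 + c * Y) / (1 - c * Y)"
      using px py by (simp_all add: field_simps)
    ultimately show ?thesis
      unfolding DN by (simp add: diff_divide_distrib)
  qed
  finally show "cosh (sqrt c * hyp_dist c x y) =
      (conformal_factor c x - 1) * (conformal_factor c y - 1)
        - c * conformal_factor c x * conformal_factor c y * (x \<bullet> y)"
    by (simp add: conformal_factor_def X_def Y_def I_def)
qed

section \<open>Passage between the ball and the hyperboloid\<close>

text \<open>This is stereographic projection from the hyperboloid, with \<open>s\<close> the time
  coordinate: \<open>c * (norm w)\<^sup>2 = (s - 1) * (s + 1)\<close>, so one factor
  \<open>1 + s\<close> cancels. It serves both the layer output and the nearest point of the
  hyperplane.\<close>

lemma
  fixes w :: "'a::real_inner"
  assumes c: "c > 0"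
  defines "s \<equiv> sqrt (1 + c * (norm w)\<^sup>2)"
  shows ball_chart_in_ball: "w /\<^sub>R (1 + s) \<in> poincare_ball c"
    and conformal_factor_ball_chart: "conformal_factor c (w /\<^sub>R (1 + s)) = 1 + s"
proof -
  have s: "s \<ge> 1" and s2: "s\<^sup>2 = 1 + c * (norm w)\<^sup>2"
    using c by (simp_all add: s_def)
  have "c * (norm (w /\<^sub>R (1 + s)))\<^sup>2 = c * (norm w)\<^sup>2 / (1 + s)\<^sup>2"
    by (simp add: power_mult_distrib power_inverse divide_inverse mult_ac)
  also have "\<dots> = (s - 1) * (s + 1) / (1 + s)\<^sup>2"
    using s2 by (simp add: power2_eq_square algebra_simps)
  also have "\<dots> = (s - 1) / (1 + s)"
    using s by (simp add: power2_eq_square add.commute)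
  finally have e: "c * (norm (w /\<^sub>R (1 + s)))\<^sup>2 = (s - 1) / (1 + s)" .
  show "w /\<^sub>R (1 + s) \<in> poincare_ball c"
    unfolding poincare_ball_def using e s by simp
  have "1 - (s - 1) / (1 + s) = 2 / (1 + s)"
    using s by (simp add: field_simps)
  then show "conformal_factor c (w /\<^sub>R (1 + s)) = 1 + s"
    unfolding conformal_factor_def e by simp
qed

lemma conformal_factor_gt_0:
  "x \<in> poincare_ball c \<Longrightarrow> conformal_factor c x > 0"
  by (simp add: conformal_factor_def poincare_ball_def)

lemma conformal_factor_ge_2:
  assumes "c \<ge> 0" "x \<in> poincare_ball c"
  shows "conformal_factor c x \<ge> 2"
  using assms by (simp add: conformal_factor_def poincare_ball_def field_simps)

text \<open>The hyperboloid equation, time squared minus space squared equals 1. It follows from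
  \<open>l * (1 - c * (norm x)\<^sup>2) = 2\<close> on multiplying by \<open>l\<close> and
  completing the square.\<close>

lemma conformal_factor_hyperboloid:
  assumes "x \<in> poincare_ball c"
  shows "(conformal_factor c x - 1)\<^sup>2 = 1 + c * (conformal_factor c x * norm x)\<^sup>2"
proof -
  let ?a = "1 - c * (norm x)\<^sup>2"
  have a: "?a \<noteq> 0"
    using assms by (simp add: poincare_ball_def)
  define l where "l = conformal_factor c x"
  have "l * ?a = 2"
    using a unfolding conformal_factor_def l_def by (metis nonzero_eq_divide_eq)
  then have "l * (l * ?a) = l * 2"
    by simp
  then show ?thesis
    unfolding l_def[symmetric] by (simp add: power2_eq_square algebra_simps)
qed

section \<open>Distance to a coordinate hyperplane\<close>

text \<open>The two-squares identity writes \<open>(s * t)\<^sup>2\<close> as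
  \<open>(C + a * b)\<^sup>2\<close> plus a square. That square vanishes for
  \<open>b = a / C\<close>, which is the case realised by the nearest point below.\<close>

lemma reversed_cauchy_schwarz:
  fixes a b s t C :: real
  assumes "s \<ge> 0" "t \<ge> 0" and "s\<^sup>2 = C\<^sup>2 + a\<^sup>2" "t\<^sup>2 = 1 + b\<^sup>2"
  shows "s * t - a * b \<ge> C"
proof -
  have "(s * t)\<^sup>2 = (C + a * b)\<^sup>2 + (C * b - a)\<^sup>2"
    unfolding power_mult_distrib assms(3,4) by algebra
  then have "(C + a * b)\<^sup>2 \<le> (s * t)\<^sup>2"
    by simp
  moreover have "s * t \<ge> 0"
    using assms by simp
  ultimately show ?thesis
    using power2_le_imp_le by fastforce
qed

text \<open>Specifying \<open>d\<close> through its sinh matches what the layer supplies. The proof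
  bounds all distances below by \<open>d\<close> and then exhibits a point attaining it.\<close>

lemma hyp_dist_set_axis_hyperplane:
  fixes y :: "real ^ 'm::finite"
  assumes c: "c > 0" and y: "y \<in> poincare_ball c"
    and d: "d \<ge> 0" "sinh (sqrt c * d) = sqrt c * conformal_factor c y * \<bar>y $ k\<bar>"
  shows "hyp_dist_set c y (axis_hyperplane c k) = d"
proof -
  define l where "l = conformal_factor c y"
  define p where "p = y - axis k (y $ k)"
  define C where "C = cosh (sqrt c * d)"
  have p_k: "p $ k = 0"
    by (simp add: p_def)
  have y_p: "y = p + axis k (y $ k)"
    by (simp add: p_def)
  have y_inner: "y \<bullet> u = p \<bullet> u" if "u $ k = 0" for u
    by (subst y_p) (simp add: inner_add_left inner_axis' that)
  have l2: "l \<ge> 2"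
    using conformal_factor_ge_2[OF _ y] c by (simp add: l_def)
  have "C \<ge> 1"
    by (simp add: C_def cosh_real_ge_1)
  have norm_y: "(norm y)\<^sup>2 = (norm p)\<^sup>2 + (y $ k)\<^sup>2"
    unfolding power2_norm_eq_inner
    by (subst (1 2) y_p) (simp add: inner_add_left inner_add_right inner_axis inner_axis' p_k
        power2_eq_square)
  have "C\<^sup>2 = 1 + c * l\<^sup>2 * (y $ k)\<^sup>2"
    unfolding C_def cosh_square_eq d(2) l_def using c by (simp add: power_mult_distrib)
  \<comment> \<open>Removing the \<open>k\<close>-th entry from the hyperboloid equation raises the
    Lorentz square from 1 to \<open>C\<^sup>2\<close>.\<close>
  then have l_sq: "(l - 1)\<^sup>2 = C\<^sup>2 + (sqrt c * l * norm p)\<^sup>2"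
    unfolding l_def conformal_factor_hyperboloid[OF y] power_mult_distrib norm_y
    using c by (simp add: algebra_simps)

  have lower: "d \<le> hyp_dist c y u" if u: "u \<in> axis_hyperplane c k" for u
  proof -
    define q where "q = conformal_factor c u"
    have ub: "u \<in> poincare_ball c" and uk: "u $ k = 0"
      using u by (auto simp: axis_hyperplane_def)
    have q2: "q \<ge> 2"
      using conformal_factor_ge_2[OF _ ub] c by (simp add: q_def)
    have q_sq: "(q - 1)\<^sup>2 = 1 + (sqrt c * q * norm u)\<^sup>2"
      unfolding q_def conformal_factor_hyperboloid[OF ub] using c
      by (simp add: power_mult_distrib)
    have "C \<le> (l - 1) * (q - 1) - (sqrt c * l * norm p) * (sqrt c * q * norm u)"
      using reversed_cauchy_schwarz[OF _ _ l_sq q_sq] l2 q2 by simp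
    also have "\<dots> = (l - 1) * (q - 1) - c * l * q * (norm p * norm u)"
      using c real_sqrt_mult_self[of c] by (simp add: mult_ac)
    also have "\<dots> \<le> (l - 1) * (q - 1) - c * l * q * (p \<bullet> u)"
      using c l2 q2 norm_cauchy_schwarz[of p u] by (simp add: mult_left_mono)
    also have "\<dots> = cosh (sqrt c * hyp_dist c y u)"
      unfolding cosh_hyp_dist[OF c y ub] by (simp add: y_inner[OF uk] l_def q_def)
    finally show ?thesis
      using c d(1) hyp_dist_nonneg[OF c y ub] by (simp add: C_def cosh_real_nonneg_le_iff)
  qed

  \<comment> \<open>The reduced vector, with time \<open>l - 1\<close> and space part
    \<open>sqrt c * l\<close> times \<open>p\<close>, has Lorentz length \<open>C\<close>. Dividing
    it by \<open>C\<close> returns it to the hyperboloid; \<open>w\<close> is the new space part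
    without \<open>sqrt c\<close>, and \<open>u\<close> its image in the ball.\<close>
  define w where "w = (l / C) *\<^sub>R p"
  define u where "u = w /\<^sub>R (1 + sqrt (1 + c * (norm w)\<^sup>2))"
  have s: "sqrt (1 + c * (norm w)\<^sup>2) = (l - 1) / C"
  proof (rule real_sqrt_unique)
    show "((l - 1) / C)\<^sup>2 = 1 + c * (norm w)\<^sup>2"
      using \<open>C \<ge> 1\<close> c by (simp add: power_divide l_sq w_def power_mult_distrib field_simps)
  qed (use l2 \<open>C \<ge> 1\<close> in auto)
  define q where "q = conformal_factor c u"
  have ub: "u \<in> poincare_ball c" and q: "q = 1 + (l - 1) / C"
    unfolding u_def q_def using ball_chart_in_ball[OF c] conformal_factor_ball_chart[OF c]
    by (auto simp flip: s)
  have uk: "u $ k = 0"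
    by (simp add: u_def w_def p_k)
  have "q > 0"
    unfolding q_def by (rule conformal_factor_gt_0[OF ub])
  have qu: "q *\<^sub>R u = w"
    using \<open>q > 0\<close> by (simp add: u_def s flip: q)
  have "cosh (sqrt c * hyp_dist c y u) = (l - 1) * (q - 1) - c * l * (p \<bullet> (q *\<^sub>R u))"
    unfolding cosh_hyp_dist[OF c y ub] by (simp add: y_inner[OF uk] l_def q_def)
  \<comment> \<open>The second vector is the reduced vector over \<open>C\<close>, so the product
    becomes a Lorentz square over \<open>C\<close>, that is \<open>C\<^sup>2 / C\<close>.\<close>
  also have "\<dots> = ((l - 1)\<^sup>2 - (sqrt c * l * norm p)\<^sup>2) / C"
  proof -
    have "(sqrt c * l * norm p)\<^sup>2 = c * l\<^sup>2 * (norm p)\<^sup>2"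
      using c by (simp add: power_mult_distrib)
    moreover have "p \<bullet> w = l / C * (norm p)\<^sup>2"
      by (simp add: w_def power2_norm_eq_inner)
    ultimately show ?thesis
      unfolding qu by (simp only: q) (simp add: power2_eq_square add_divide_distrib
          diff_divide_distrib algebra_simps)
  qed
  also have "\<dots> = C"
    unfolding l_sq using \<open>C \<ge> 1\<close> by (simp add: power2_eq_square)
  finally have "hyp_dist c y u \<le> d"
    using c d(1) hyp_dist_nonneg[OF c y ub]
      cosh_real_nonneg_le_iff[of "sqrt c * hyp_dist c y u" "sqrt c * d"]
    by (simp add: C_def)
  moreover have u: "u \<in> axis_hyperplane c k"
    using ub uk by (simp add: axis_hyperplane_def)
  ultimately have "hyp_dist c y u = d"
    using lower[OF u] by simp
  \<comment> \<open>The bound is attained at \<open>u\<close>, so the infimum is a minimum.\<close>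
  with u show ?thesis
    unfolding hyp_dist_set_def using lower by (intro cInf_eq_minimum) auto
qed

section \<open>Signed distances of the layer output\<close>

theorem mainTheorem3:
  fixes c :: real
    and z :: "'m::finite \<Rightarrow> real ^ 'n"
    and r :: "'m \<Rightarrow> real"
    and x :: "real ^ 'n"
  assumes "c > 0"
    and "\<And>k. z k \<noteq> 0"
    and "x \<in> poincare_ball c"
  shows "poincare_fc c z r x \<in> poincare_ball c
    \<and> (\<forall>k. sgn (poincare_fc c z r x $ k)
             * hyp_dist_set c (poincare_fc c z r x) (axis_hyperplane c k)
           = poincare_mlr c (z k) (r k) x)"
proof (intro conjI allI)
  let ?w = "poincare_fc_w c z r x" and ?y = "poincare_fc c z r x"
  define s where "s = sqrt (1 + c * (norm ?w)\<^sup>2)"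
  have y: "?y = ?w /\<^sub>R (1 + s)"
    by (simp add: poincare_fc_def s_def)
  show ball: "?y \<in> poincare_ball c"
    unfolding y s_def by (rule ball_chart_in_ball[OF assms(1)])
  have l: "conformal_factor c ?y = 1 + s"
    unfolding y s_def by (rule conformal_factor_ball_chart[OF assms(1)])
  have s: "1 + s > 0"
    using conformal_factor_gt_0[OF ball] l by simp
  fix k
  define v where "v = poincare_mlr c (z k) (r k) x"
  \<comment> \<open>Multiplying by the conformal factor \<open>1 + s\<close> undoes the rescaling
    and recovers the \<open>k\<close>-th entry of \<open>w\<close>.\<close>
  have yk: "sqrt c * (1 + s) * ?y $ k = sinh (sqrt c * v)"
    using assms(1) s by (simp add: y poincare_fc_w_def v_def)
  have sinh_abs: "sinh \<bar>t\<bar> = \<bar>sinh t\<bar>" for t :: real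
    by (simp add: abs_if)
  \<comment> \<open>The distance only sees the absolute value of \<open>v\<close>; since sinh is
    odd, the sign can be split off and restored at the end.\<close>
  have "sinh (sqrt c * \<bar>v\<bar>) = \<bar>sinh (sqrt c * v)\<bar>"
    using assms(1) sinh_abs[of "sqrt c * v"] by (simp add: abs_mult)
  also have "\<dots> = sqrt c * conformal_factor c ?y * \<bar>?y $ k\<bar>"
    unfolding yk[symmetric] l using assms(1) s by (simp add: abs_mult)
  finally have "hyp_dist_set c ?y (axis_hyperplane c k) = \<bar>v\<bar>"
    by (intro hyp_dist_set_axis_hyperplane[OF assms(1) ball]) simp_all
  moreover have "sgn (?y $ k) = sgn v"
  proof -
    have "sgn (sqrt c * (1 + s) * ?y $ k) = sgn (?y $ k)"
      using assms(1) s by (simp add: sgn_mult)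
    moreover have "sgn (sinh (sqrt c * v)) = sgn v"
      using assms(1) by (simp add: sgn_if zero_less_mult_iff)
    ultimately show ?thesis
      using yk by simp
  qed
  ultimately show "sgn (?y $ k) * hyp_dist_set c ?y (axis_hyperplane c k)
      = poincare_mlr c (z k) (r k) x"
    by (simp add: v_def sgn_mult_abs)
qed

end
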